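(* Let $(P_t^\varepsilon,\pi^\varepsilon)_{\varepsilon>0}$ be a family of microscopic semigroups and $(\bar P_t,\bar\pi)$ a macroscopic semigroup as in the context, and suppose that the coefficient convergence condition stated in the context holds. Then $$\liminf_{\varepsilon\downarrow0}\sigma_{\mathrm{hk,ss}}^\varepsilon\ \ge\ \bar\sigma_{\mathrm{hk,ss}},$$ where $\sigma_{\mathrm{hk,ss}}^\varepsilon=\int_E(\gamma^\varepsilon)^\top(A^\varepsilon)^{-1}\gamma^\varepsilon\,d\pi^\varepsilon$ and $\bar\sigma_{\mathrm{hk,ss}}=\int_{\bar E}\bar\gamma^\top\bar A^{-1}\bar\gamma\,d\bar\pi$.
   Context: **Spaces.** $E\subset\mathbb R^N$ and $\bar E\subset\mathbb R^n$ are open and connected; $\Phi:E\to\bar E$ is a surjective $C^1$ map with $\operatorname{rank}D\Phi=n$. **Semigroups (standing assumptions).** For each $\varepsilon>0$, $(P_t^\varepsilon)_{t\ge0}$ is a Markov semigroup on $E$, and $(\bar P_t)_{t\ge0}$ is a Markov semigroup on $\bar E$. Each satisfies the following (written for a semigroup $(P_t)$ on $X\subset\mathbb R^d$, $(X,d)=(E,N)$ or $(\bar E,n)$): $P_t$ maps $C_b(X)$ to $C_b(X)$ with $\|P_tf\|_\infty\le\|f\|_\infty$; it has a unique invariant probability measure $\pi(d\zeta)=e^{-V(\zeta)}d\zeta$ with $V\in W^{2,\infty}_{loc}(X)$; it is strongly continuous on $L^2(\pi)$ with generator $\mathcal L$; $C_c^\infty(X)$ is a core for $\mathcal L$; and for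 $\varphi\in C_c^\infty(X)$, $\mathcal L\varphi=-\langle\gamma,\nabla\varphi\rangle+e^{V}\nabla\cdot(e^{-V}A\nabla\varphi)$, where $A\in W^{2,\infty}_{loc}(X;\mathbb R^{d\times d})$ is symmetric and locally uniformly positive definite, and $\gamma\in W^{1,\infty}_{loc}(X;\mathbb R^d)$ satisfies $\nabla\cdot(\gamma e^{-V})=0$. Objects attached to $P^\varepsilon$ carry a superscript $\varepsilon$; those attached to $\bar P$ carry an overbar. **Coefficient convergence condition.** For some $\varepsilon_0>0$: (i) $\bar J:=\bar\gamma\bar\pi$ is a finite $\mathbb R^n$-valued measure on $\bar E$ and for every $\xi\in C_b(\bar E;\mathbb R^n)$, $\int_E\langle\xi(\Phi(z)),D\Phi(z)\gamma^\varepsilon(z)\rangle d\pi^\varepsilon(z)\to\int_{\bar E}\langle\xi,d\bar J\rangle$ as $\varepsilon\to0$. (ii) The matrix-valued measures $Q^\varepsilon:=(D\Phi A^\varepsilon D\Phi^\top)\pi^\varepsilon$ are finite, and there are a finite measure $Q$ on $E$ with values in the positive semidefinite symmetric matrices $\mathbb S^n_+$ and the finite measure $\bar Q:=\bar A\bar\pi$ such that $\int_E\mathrm{tr}(\eta\,dQ^\varepsilon)\to\int_E\mathrm{tr}(\eta\,dQ)<\infty$ for all $\eta\in C_b(E;\mathbb S_+^n)$ and $\Phi_\#Q=\bar Q$. (iii) $\sup_{0<\varepsilon<\varepsilon_0}\int_E(D\Phi\gamma^\varepsilon)^\top(D\Phi A^\varepsilon D\Phi^\top)^{-1}(D\Phi\gamma^\varepsilon)\,d\pi^\varepsilon<\infty$.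 *)

theory Defs
  imports "HOL-Probability.Probability"
begin

text \<open>
  Functions on an open set \<open>X\<close> are total functions on the ambient space whose values
  outside \<open>X\<close> are irrelevant; measures on \<open>X\<close> have \<open>X\<close> as their space.
\<close>

section \<open>Function spaces\<close>

definition Cb :: "'a::topological_space set \<Rightarrow> ('a \<Rightarrow> 'b::real_normed_vector) set" where
  "Cb X = {f. continuous_on X f \<and> bounded (f ` X)}"

definition C1_on :: "(real^'m) set \<Rightarrow> (real^'m \<Rightarrow> real^'n) \<Rightarrow> bool" where
  "C1_on X f \<longleftrightarrow> (\<forall>x\<in>X. f differentiable (at x)) \<and> continuous_on X (\<lambda>x. jacobian f (at x))"

definition partial :: "'d::finite \<Rightarrow> (real^'d \<Rightarrow> real) \<Rightarrow> real^'d \<Rightarrow> real" where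
  "partial i f x = frechet_derivative f (at x) (axis i 1)"

definition grad :: "(real^'d \<Rightarrow> real) \<Rightarrow> real^'d \<Rightarrow> real^'d" where
  "grad f x = (\<chi> i. partial i f x)"

fun Ck :: "nat \<Rightarrow> (real^'d \<Rightarrow> real) \<Rightarrow> bool" where
  "Ck 0 f \<longleftrightarrow> continuous_on UNIV f"
| "Ck (Suc k) f \<longleftrightarrow> (\<forall>x. f differentiable (at x)) \<and> (\<forall>i. Ck k (partial i f))"

definition Cc_inf :: "(real^'d) set \<Rightarrow> (real^'d \<Rightarrow> real) set" where
  "Cc_inf X = {\<phi>. (\<forall>k. Ck k \<phi>) \<and> (\<exists>K. compact K \<and> K \<subseteq> X \<and> (\<forall>x. x \<notin> K \<longrightarrow> \<phi> x = 0))}"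

definition locally_integrable_on ::
  "(real^'d) set \<Rightarrow> (real^'d \<Rightarrow> 'b::{banach,second_countable_topology}) \<Rightarrow> bool" where
  "locally_integrable_on X f \<longleftrightarrow> (\<forall>K. compact K \<and> K \<subseteq> X \<longrightarrow> set_integrable lborel K f)"

definition weak_partial ::
  "(real^'d) set \<Rightarrow> 'd \<Rightarrow> (real^'d \<Rightarrow> real) \<Rightarrow> (real^'d \<Rightarrow> real) \<Rightarrow> bool" where
  "weak_partial X i f g \<longleftrightarrow> locally_integrable_on X f \<and> locally_integrable_on X g \<and>
     (\<forall>\<phi>\<in>Cc_inf X. (LINT x:X|lborel. f x * partial i \<phi> x) = - (LINT x:X|lborel. g x * \<phi> x))"

definition weak_div ::
  "(real^'d) set \<Rightarrow> (real^'d \<Rightarrow> real^'d) \<Rightarrow> (real^'d \<Rightarrow> real) \<Rightarrow> bool" where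
  "weak_div X F h \<longleftrightarrow> locally_integrable_on X F \<and> locally_integrable_on X h \<and>
     (\<forall>\<phi>\<in>Cc_inf X. (LINT x:X|lborel. F x \<bullet> grad \<phi> x) = - (LINT x:X|lborel. h x * \<phi> x))"

definition Linf_loc :: "(real^'d) set \<Rightarrow> (real^'d \<Rightarrow> real) \<Rightarrow> bool" where
  "Linf_loc X f \<longleftrightarrow> f \<in> borel_measurable (restrict_space borel X) \<and>
     (\<forall>K. compact K \<and> K \<subseteq> X \<longrightarrow> (\<exists>C. AE x in lborel. x \<in> K \<longrightarrow> \<bar>f x\<bar> \<le> C))"

fun Wk_inf_loc :: "nat \<Rightarrow> (real^'d) set \<Rightarrow> (real^'d \<Rightarrow> real) \<Rightarrow> bool" where
  "Wk_inf_loc 0 X f \<longleftrightarrow> Linf_loc X f"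
| "Wk_inf_loc (Suc k) X f \<longleftrightarrow>
     Linf_loc X f \<and> (\<forall>i. \<exists>g. weak_partial X i f g \<and> Wk_inf_loc k X g)"

section \<open>Markov semigroups and their generators on \<open>L\<^sup>2\<close>\<close>

text \<open>
  The semigroup is given by its action on bounded continuous functions; its action on
  \<open>L\<^sup>2(\<pi>)\<close> is the continuous extension. A Feller semigroup of transition kernels
  is an instance.
\<close>

definition markov_semigroup ::
  "(real^'d) set \<Rightarrow> (real \<Rightarrow> (real^'d \<Rightarrow> real) \<Rightarrow> (real^'d \<Rightarrow> real)) \<Rightarrow> bool" where
  "markov_semigroup X P \<longleftrightarrow>
     (\<forall>t\<ge>0. \<forall>f\<in>Cb X. P t f \<in> Cb X \<and> (SUP x\<in>X. \<bar>P t f x\<bar>) \<le> (SUP x\<in>X. \<bar>f x\<bar>)) \<and>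
     (\<forall>t\<ge>0. \<forall>f\<in>Cb X. \<forall>g\<in>Cb X. \<forall>a b. \<forall>x\<in>X.
        P t (\<lambda>y. a * f y + b * g y) x = a * P t f x + b * P t g x) \<and>
     (\<forall>t\<ge>0. \<forall>f\<in>Cb X. (\<forall>x\<in>X. 0 \<le> f x) \<longrightarrow> (\<forall>x\<in>X. 0 \<le> P t f x)) \<and>
     (\<forall>t\<ge>0. \<forall>x\<in>X. P t (\<lambda>_. 1) x = 1) \<and>
     (\<forall>f\<in>Cb X. \<forall>x\<in>X. P 0 f x = f x) \<and>
     (\<forall>s\<ge>0. \<forall>t\<ge>0. \<forall>f\<in>Cb X. \<forall>x\<in>X. P (s + t) f x = P s (P t f) x)"

definition invariant_prob ::
  "(real^'d) set \<Rightarrow> (real \<Rightarrow> (real^'d \<Rightarrow> real) \<Rightarrow> (real^'d \<Rightarrow> real)) \<Rightarrow> (real^'d) measure \<Rightarrow> bool" where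
  "invariant_prob X P \<mu> \<longleftrightarrow> sets \<mu> = sets (restrict_space borel X) \<and> prob_space \<mu> \<and>
     (\<forall>t\<ge>0. \<forall>f\<in>Cb X. (\<integral>x. P t f x \<partial>\<mu>) = (\<integral>x. f x \<partial>\<mu>))"

definition L2 :: "'a measure \<Rightarrow> ('a \<Rightarrow> real) set" where
  "L2 M = {f \<in> borel_measurable M. integrable M (\<lambda>x. (f x)\<^sup>2)}"

definition tendsto_L2 ::
  "'a measure \<Rightarrow> ('i \<Rightarrow> 'a \<Rightarrow> real) \<Rightarrow> ('a \<Rightarrow> real) \<Rightarrow> 'i filter \<Rightarrow> bool" where
  "tendsto_L2 M u f F \<longleftrightarrow> ((\<lambda>i. \<integral>\<^sup>+x. ennreal ((u i x - f x)\<^sup>2) \<partial>M) \<longlongrightarrow> 0) F"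

text \<open>Determined up to \<open>\<pi>\<close>-null sets, since \<open>P\<close> is an \<open>L\<^sup>2(\<pi>)\<close>-contraction on \<open>Cb X\<close>.\<close>

definition L2_ext ::
  "(real^'d) set \<Rightarrow> (real \<Rightarrow> (real^'d \<Rightarrow> real) \<Rightarrow> (real^'d \<Rightarrow> real)) \<Rightarrow> (real^'d) measure \<Rightarrow>
   real \<Rightarrow> (real^'d \<Rightarrow> real) \<Rightarrow> (real^'d \<Rightarrow> real)" where
  "L2_ext X P \<pi> t f = (SOME g. g \<in> L2 \<pi> \<and> (\<exists>u. (\<forall>k::nat. u k \<in> Cb X) \<and>
     tendsto_L2 \<pi> u f sequentially \<and> tendsto_L2 \<pi> (\<lambda>k. P t (u k)) g sequentially))"

definition strongly_continuous_L2 ::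
  "'a measure \<Rightarrow> (real \<Rightarrow> ('a \<Rightarrow> real) \<Rightarrow> ('a \<Rightarrow> real)) \<Rightarrow> bool" where
  "strongly_continuous_L2 M T \<longleftrightarrow> (\<forall>f\<in>L2 M. tendsto_L2 M (\<lambda>t. T t f) f (at_right 0))"

text \<open>The graph of the generator.\<close>

definition generator_L2 ::
  "'a measure \<Rightarrow> (real \<Rightarrow> ('a \<Rightarrow> real) \<Rightarrow> ('a \<Rightarrow> real)) \<Rightarrow> (('a \<Rightarrow> real) \<times> ('a \<Rightarrow> real)) set" where
  "generator_L2 M T = {(f, g). f \<in> L2 M \<and> g \<in> L2 M \<and>
     tendsto_L2 M (\<lambda>t x. (T t f x - f x) / t) g (at_right 0)}"

definition is_core ::
  "'a measure \<Rightarrow> (('a \<Rightarrow> real) \<times> ('a \<Rightarrow> real)) set \<Rightarrow> ('a \<Rightarrow> real) set \<Rightarrow> bool" where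
  "is_core M G D \<longleftrightarrow> D \<subseteq> Domain G \<and>
     (\<forall>(f, g)\<in>G. \<exists>u v. (\<forall>k::nat. u k \<in> D \<and> (u k, v k) \<in> G) \<and>
        tendsto_L2 M u f sequentially \<and> tendsto_L2 M v g sequentially)"

text \<open>
  The coefficients are Borel representatives of Sobolev classes, so pointwise conditions on
  them are imposed almost everywhere, and divergences are weak.
\<close>

locale diffusion_semigroup =
  fixes X :: "(real^'d) set"
    and P :: "real \<Rightarrow> (real^'d \<Rightarrow> real) \<Rightarrow> (real^'d \<Rightarrow> real)"
    and \<pi> :: "(real^'d) measure"
    and V :: "real^'d \<Rightarrow> real"
    and A :: "real^'d \<Rightarrow> real^'d^'d"
    and \<gamma> :: "real^'d \<Rightarrow> real^'d"
  assumes semigroup: "markov_semigroup X P"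
    and invariant: "invariant_prob X P \<pi>"
    and invariant_unique: "\<And>\<mu>. invariant_prob X P \<mu> \<Longrightarrow> \<mu> = \<pi>"
    and V_W2: "Wk_inf_loc 2 X V"
    and density_pi: "\<pi> = density (restrict_space lborel X) (\<lambda>x. ennreal (exp (- V x)))"
    and strongly_continuous: "strongly_continuous_L2 \<pi> (L2_ext X P \<pi>)"
    and core: "is_core \<pi> (generator_L2 \<pi> (L2_ext X P \<pi>)) (Cc_inf X)"
    and A_W2: "\<And>i j. Wk_inf_loc 2 X (\<lambda>x. A x $ i $ j)"
    and A_symmetric: "AE x in lborel. x \<in> X \<longrightarrow> transpose (A x) = A x"
    and A_elliptic: "\<And>K. compact K \<Longrightarrow> K \<subseteq> X \<Longrightarrow>
       \<exists>c>0. AE x in lborel. x \<in> K \<longrightarrow> (\<forall>v. c * (v \<bullet> v) \<le> v \<bullet> (A x *v v))"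
    and gamma_W1: "\<And>i. Wk_inf_loc 1 X (\<lambda>x. \<gamma> x $ i)"
    and gamma_div: "weak_div X (\<lambda>x. exp (- V x) *\<^sub>R \<gamma> x) (\<lambda>_. 0)"
    and generator: "\<And>\<phi>. \<phi> \<in> Cc_inf X \<Longrightarrow>
       \<exists>h. weak_div X (\<lambda>x. exp (- V x) *\<^sub>R (A x *v grad \<phi> x)) h \<and>
         (\<phi>, \<lambda>x. - (\<gamma> x \<bullet> grad \<phi> x) + exp (V x) * h x) \<in> generator_L2 \<pi> (L2_ext X P \<pi>)"

section \<open>Matrix-valued measures\<close>

definition psd :: "real^'n^'n \<Rightarrow> bool" where
  "psd M \<longleftrightarrow> transpose M = M \<and> (\<forall>v. 0 \<le> v \<bullet> (M *v v))"

definition psd_measure :: "(real^'m) set \<Rightarrow> ((real^'m) set \<Rightarrow> real^'n^'n) \<Rightarrow> bool" where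
  "psd_measure X Q \<longleftrightarrow> (\<forall>B\<in>sets (restrict_space borel X). psd (Q B)) \<and>
     (\<forall>B. range B \<subseteq> sets (restrict_space borel X) \<and> disjoint_family B \<longrightarrow>
        (\<lambda>k::nat. Q (B k)) sums Q (\<Union>k. B k))"

definition quad_measure ::
  "(real^'m) set \<Rightarrow> ((real^'m) set \<Rightarrow> real^'n^'n) \<Rightarrow> real^'n \<Rightarrow> (real^'m) measure" where
  "quad_measure X Q v =
     measure_of X (sets (restrict_space borel X)) (\<lambda>B. ennreal (v \<bullet> (Q B *v v)))"

text \<open>
  By polarization the signed measure \<open>Q\<^sub>i\<^sub>j\<close> is a quarter of the difference of the finite positive
  measures \<open>v \<bullet> Q v\<close> at \<open>v = e\<^sub>i + e\<^sub>j\<close> and \<open>v = e\<^sub>i - e\<^sub>j\<close>.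
\<close>

definition entry_integral ::
  "(real^'m) set \<Rightarrow> ((real^'m) set \<Rightarrow> real^'n^'n) \<Rightarrow> 'n \<Rightarrow> 'n \<Rightarrow> (real^'m \<Rightarrow> real) \<Rightarrow> real" where
  "entry_integral X Q i j f =
     ((\<integral>x. f x \<partial>quad_measure X Q (axis i 1 + axis j 1)) -
      (\<integral>x. f x \<partial>quad_measure X Q (axis i 1 - axis j 1))) / 4"

definition trace_integral ::
  "(real^'m) set \<Rightarrow> ((real^'m) set \<Rightarrow> real^'n^'n) \<Rightarrow> (real^'m \<Rightarrow> real^'n^'n) \<Rightarrow> real" where
  "trace_integral X Q \<eta> = (\<Sum>i\<in>UNIV. \<Sum>j\<in>UNIV. entry_integral X Q j i (\<lambda>x. \<eta> x $ i $ j))"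

section \<open>Convergence of coefficients and housekeeping entropy production\<close>

text \<open>
  Integrals against a measure with a matrix or vector density are written as integrals of the
  density. The integrand in the first limit is \<open>\<pi> \<epsilon>\<close>-integrable for \<open>\<epsilon> < \<epsilon>0\<close> by Cauchy--Schwarz,
  from the integrability of \<open>D \<epsilon>\<close> and the last condition.
\<close>

definition coefficient_convergence ::
  "(real^'m) set \<Rightarrow> (real^'n) set \<Rightarrow> (real^'m \<Rightarrow> real^'n) \<Rightarrow>
   (real \<Rightarrow> (real^'m) measure) \<Rightarrow> (real \<Rightarrow> real^'m \<Rightarrow> real^'m^'m) \<Rightarrow> (real \<Rightarrow> real^'m \<Rightarrow> real^'m) \<Rightarrow>
   (real^'n) measure \<Rightarrow> (real^'n \<Rightarrow> real^'n^'n) \<Rightarrow> (real^'n \<Rightarrow> real^'n) \<Rightarrow> bool" where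
  "coefficient_convergence E Eb \<Phi> \<pi> A \<gamma> \<pi>b Ab \<gamma>b \<longleftrightarrow>
    (let J = (\<lambda>z. jacobian \<Phi> (at z));
         D = (\<lambda>\<epsilon> z. J z ** A \<epsilon> z ** transpose (J z))
     in \<exists>\<epsilon>0>0.
       integrable \<pi>b \<gamma>b \<and>
       (\<forall>\<xi>\<in>Cb Eb. ((\<lambda>\<epsilon>. \<integral>z. \<xi> (\<Phi> z) \<bullet> (J z *v \<gamma> \<epsilon> z) \<partial>\<pi> \<epsilon>)
          \<longlongrightarrow> (\<integral>y. \<xi> y \<bullet> \<gamma>b y \<partial>\<pi>b)) (at_right 0)) \<and>
       (\<forall>\<epsilon>. 0 < \<epsilon> \<and> \<epsilon> < \<epsilon>0 \<longrightarrow> integrable (\<pi> \<epsilon>) (D \<epsilon>)) \<and>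
       integrable \<pi>b Ab \<and>
       (\<exists>Q. psd_measure E Q \<and>
          (\<forall>\<eta>\<in>Cb E. (\<forall>z\<in>E. psd (\<eta> z)) \<longrightarrow>
             ((\<lambda>\<epsilon>. \<integral>z. trace (\<eta> z ** D \<epsilon> z) \<partial>\<pi> \<epsilon>) \<longlongrightarrow> trace_integral E Q \<eta>) (at_right 0)) \<and>
          (\<forall>B\<in>sets (restrict_space borel Eb). Q (\<Phi> -` B \<inter> E) = (LINT y:B|\<pi>b. Ab y))) \<and>
       (SUP \<epsilon>\<in>{0<..<\<epsilon>0}.
          \<integral>\<^sup>+z. ennreal ((J z *v \<gamma> \<epsilon> z) \<bullet> (matrix_inv (D \<epsilon> z) *v (J z *v \<gamma> \<epsilon> z))) \<partial>\<pi> \<epsilon>) < \<infinity>)"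

definition sigma_hk_ss ::
  "(real^'d \<Rightarrow> real^'d^'d) \<Rightarrow> (real^'d \<Rightarrow> real^'d) \<Rightarrow> (real^'d) measure \<Rightarrow> ennreal" where
  "sigma_hk_ss A \<gamma> \<pi> = (\<integral>\<^sup>+z. ennreal (\<gamma> z \<bullet> (matrix_inv (A z) *v \<gamma> z)) \<partial>\<pi>)"

end

theory Submission
  imports Defs
begin

text \<open>
  The dissipation has a variational form: for a positive definite field \<open>A\<close>,
  \<open>\<integral> \<gamma> \<bullet> A\<^sup>-\<^sup>1 \<gamma> d\<pi>\<close> is the supremum over fields \<open>u\<close> of \<open>2 \<integral> u \<bullet> \<gamma> d\<pi> - \<integral> u \<bullet> A u d\<pi>\<close>.
  Each competitor \<open>u\<close> gives a lower bound that is linear in the current \<open>\<gamma> \<pi>\<close> and in the diffusion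
  measure \<open>A \<pi>\<close>, so it passes to weak limits, and a supremum of such limits bounds the lower limit
  of the dissipations from below.

  Microscopically only the pulled-back fields \<open>u = J\<^sup>T \<xi>(\<Phi>)\<close> are used, where \<open>J\<close> is the Jacobian of \<open>\<Phi>\<close> and \<open>\<xi>\<close> is
  a bounded continuous field on the macroscopic space. For these
  \<open>u \<bullet> \<gamma> = \<xi>(\<Phi>) \<bullet> J \<gamma>\<close> and \<open>u \<bullet> A u = \<xi>(\<Phi>) \<bullet> (J A J\<^sup>T) \<xi>(\<Phi>)\<close>, which are exactly the quantities whose
  integrals converge (\<open>variational_lower_bound\<close> is the bound before the limit). The limit of the second
  one is an integral against \<open>Q\<close> of a function of \<open>\<Phi>\<close>; since \<open>Q\<close> is pushed forward by \<open>\<Phi>\<close> to the macroscopic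
  diffusion measure, it equals the macroscopic quadratic form of \<open>\<xi>\<close>
  (\<open>trace_integral_rank_one_pushforward\<close>). Hence the lower limit of the microscopic dissipations is at
  least the macroscopic functional of every bounded continuous \<open>\<xi>\<close>, and these suffice to recover the
  macroscopic dissipation (\<open>variational_formula_continuous_tests\<close>).
\<close>

section \<open>Quadratic forms\<close>

definition positive_definite :: "real^'n^'n \<Rightarrow> bool" where
  "positive_definite M \<longleftrightarrow> transpose M = M \<and> (\<forall>v. v \<noteq> 0 \<longrightarrow> 0 < v \<bullet> (M *v v))"

lemma positive_definite_invertible:
  fixes M :: "real^'n^'n"
  assumes "positive_definite M"
  shows "invertible M"
proof -
  have "x = 0" if "M *v x = 0" for x
    using assms that unfolding positive_definite_def by (metis inner_zero_right less_irrefl)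
  then show ?thesis
    by (simp add: invertible_left_inverse matrix_left_invertible_ker)
qed

lemma invertible_matrix_inv_solves:
  fixes M :: "real^'n^'n"
  assumes "invertible M"
  shows "M *v (matrix_inv M *v g) = g"
proof -
  have "M ** matrix_inv M = mat 1 \<and> matrix_inv M ** M = mat 1"
    using assms unfolding invertible_def matrix_inv_def by (rule someI_ex)
  then show ?thesis
    by (simp add: matrix_vector_mul_assoc)
qed

text \<open>
  Young's inequality for the form \<open>M\<close>: expand \<open>(w - z) \<bullet> M (w - z) \<ge> 0\<close> at \<open>w = M\<^sup>-\<^sup>1 g\<close>.
\<close>

lemma young_quadratic_form:
  fixes M :: "real^'n^'n"
  assumes "positive_definite M"
  shows "2 * (z \<bullet> g) - z \<bullet> (M *v z) \<le> g \<bullet> (matrix_inv M *v g)"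
proof -
  define w where "w = matrix_inv M *v g"
  have Mw: "M *v w = g"
    unfolding w_def by (simp add: assms positive_definite_invertible invertible_matrix_inv_solves)
  have "transpose M = M" and pos: "0 \<le> (w - z) \<bullet> (M *v (w - z))"
    using assms unfolding positive_definite_def
    by (auto, metis inner_zero_left less_eq_real_def)
  then have sym: "w \<bullet> (M *v z) = z \<bullet> g"
    by (metis Mw dot_lmul_matrix inner_commute transpose_matrix_vector)
  show ?thesis
    using pos sym Mw
    by (simp add: matrix_vector_mult_diff_distrib inner_diff inner_commute w_def[symmetric])
qed

lemma inner_matrix_vector_eq_sum:
  fixes u :: "real^'n" and w :: "real^'m" and M :: "real^'m^'n"
  shows "u \<bullet> (M *v w) = (\<Sum>i\<in>UNIV. \<Sum>j\<in>UNIV. u $ i * w $ j * M $ i $ j)"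
  by (simp add: inner_vec_def matrix_vector_mult_def sum_distrib_left mult_ac)

lemma abs_inner_matrix_vector_le:
  fixes u :: "real^'n" and w :: "real^'m" and M :: "real^'m^'n"
  shows "\<bar>u \<bullet> (M *v w)\<bar> \<le> real CARD('n) * real CARD('m) * (norm u * norm w * norm M)"
proof -
  have "\<bar>u $ i * w $ j * M $ i $ j\<bar> \<le> norm u * norm w * norm M" for i j
  proof -
    have "\<bar>M $ i $ j\<bar> \<le> norm M"
      using component_le_norm_cart[of "M $ i" j] Finite_Cartesian_Product.norm_nth_le[of M i] by linarith
    then show ?thesis
      by (simp add: abs_mult mult_mono component_le_norm_cart)
  qed
  then have "(\<Sum>i\<in>UNIV. \<Sum>j\<in>UNIV. \<bar>u $ i * w $ j * M $ i $ j\<bar>)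
      \<le> (\<Sum>i\<in>(UNIV::'n set). \<Sum>j\<in>(UNIV::'m set). norm u * norm w * norm M)"
    by (intro sum_mono)
  then show ?thesis
    unfolding inner_matrix_vector_eq_sum
    by (intro order_trans[OF sum_abs] order_trans[OF sum_mono[OF sum_abs]]) (simp add: mult.assoc)
qed

section \<open>Measurability and integrability of vector and matrix fields\<close>

lemma borel_measurable_nth_field:
  fixes f :: "'a \<Rightarrow> 'b::{real_normed_vector,second_countable_topology}^'n"
  assumes "f \<in> borel_measurable M"
  shows "(\<lambda>x. f x $ i) \<in> borel_measurable M"
  using assms by (rule borel_measurable_continuous_on[rotated]) (intro continuous_intros)

lemma borel_measurable_vec_field:
  fixes f :: "'a \<Rightarrow> real^'n"
  assumes "\<And>i. (\<lambda>x. f x $ i) \<in> borel_measurable M"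
  shows "f \<in> borel_measurable M"
proof -
  have "(\<lambda>x. f x \<bullet> b) \<in> borel_measurable M" if "b \<in> Basis" for b
  proof -
    obtain i where "b = axis i 1"
      using \<open>b \<in> Basis\<close> by (auto simp: Basis_vec_def)
    then show ?thesis
      using assms[of i] by (simp add: inner_axis)
  qed
  then show ?thesis
    by (subst borel_measurable_euclidean_space) blast
qed

lemma borel_measurable_det:
  fixes C :: "'a \<Rightarrow> real^'n^'n"
  assumes "\<And>i j. (\<lambda>x. C x $ i $ j) \<in> borel_measurable M"
  shows "(\<lambda>x. det (C x)) \<in> borel_measurable M"
  unfolding det_def using assms by measurable

lemma borel_measurable_inner_matrix_vector:
  fixes u :: "'a \<Rightarrow> real^'n" and w :: "'a \<Rightarrow> real^'m" and B :: "'a \<Rightarrow> real^'m^'n"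
  assumes "u \<in> borel_measurable M" "w \<in> borel_measurable M" "B \<in> borel_measurable M"
  shows "(\<lambda>x. u x \<bullet> (B x *v w x)) \<in> borel_measurable M"
  unfolding inner_matrix_vector_eq_sum
  by (intro borel_measurable_sum borel_measurable_times borel_measurable_nth_field assms)

lemma integrable_inner_matrix_vector:
  fixes u :: "'a \<Rightarrow> real^'n" and w :: "'a \<Rightarrow> real^'m" and B :: "'a \<Rightarrow> real^'m^'n"
  assumes "u \<in> borel_measurable M" "w \<in> borel_measurable M" "integrable M B"
    and "\<And>x. x \<in> space M \<Longrightarrow> norm (u x) \<le> R" "\<And>x. x \<in> space M \<Longrightarrow> norm (w x) \<le> S"
  shows "integrable M (\<lambda>x. u x \<bullet> (B x *v w x))"
proof (rule Bochner_Integration.integrable_bound)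
  show "integrable M (\<lambda>x. real CARD('n) * real CARD('m) * (R * S * norm (B x)))"
    using assms(3) by simp
  show "(\<lambda>x. u x \<bullet> (B x *v w x)) \<in> borel_measurable M"
    by (intro borel_measurable_inner_matrix_vector assms borel_measurable_integrable)
  show "AE x in M. norm (u x \<bullet> (B x *v w x))
      \<le> norm (real CARD('n) * real CARD('m) * (R * S * norm (B x)))"
  proof (rule AE_I2)
    fix x assume "x \<in> space M"
    then have "norm (u x) * norm (w x) \<le> R * S"
      using assms(4,5) by (intro mult_mono) (auto intro: order_trans[OF norm_ge_zero])
    then have "real CARD('n) * real CARD('m) * (norm (u x) * norm (w x) * norm (B x))
        \<le> real CARD('n) * real CARD('m) * (R * S * norm (B x))"
      by (intro mult_left_mono mult_right_mono) auto
    then show "norm (u x \<bullet> (B x *v w x))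
        \<le> norm (real CARD('n) * real CARD('m) * (R * S * norm (B x)))"
      unfolding real_norm_def
      by (intro order_trans[OF abs_inner_matrix_vector_le order_trans[OF _ abs_ge_self]])
  qed
qed

lemma integrable_inner_bounded:
  fixes u g :: "'a \<Rightarrow> real^'n"
  assumes "u \<in> borel_measurable M" "integrable M g" "\<And>x. x \<in> space M \<Longrightarrow> norm (u x) \<le> R"
  shows "integrable M (\<lambda>x. u x \<bullet> g x)"
proof (rule Bochner_Integration.integrable_bound)
  show "integrable M (\<lambda>x. R * norm (g x))"
    using assms(2) by simp
  show "(\<lambda>x. u x \<bullet> g x) \<in> borel_measurable M"
    using assms(1,2) by measurable
  show "AE x in M. norm (u x \<bullet> g x) \<le> norm (R * norm (g x))"
  proof (rule AE_I2)
    fix x assume "x \<in> space M"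
    then have "norm (u x) * norm (g x) \<le> R * norm (g x)"
      using assms(3) by (intro mult_right_mono) auto
    then show "norm (u x \<bullet> g x) \<le> norm (R * norm (g x))"
      using Cauchy_Schwarz_ineq2[of "u x" "g x"] by simp
  qed
qed

section \<open>The variational formula for the housekeeping dissipation\<close>

text \<open>
  Integrating Young's inequality. The integral of \<open>u \<bullet> g\<close> takes the default value \<open>0\<close> if that function
  is not integrable; when the right-hand side is finite, Young's inequality at \<open>u\<close> and \<open>- u\<close> rules
  this out.
\<close>

lemma variational_lower_bound:
  fixes u g :: "'a \<Rightarrow> real^'n" and B :: "'a \<Rightarrow> real^'n^'n"
  assumes pd: "AE x in M. positive_definite (B x)"
    and meas: "(\<lambda>x. u x \<bullet> g x) \<in> borel_measurable M"
    and int: "integrable M (\<lambda>x. u x \<bullet> (B x *v u x))"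
  shows "ennreal (2 * (\<integral>x. u x \<bullet> g x \<partial>M) - (\<integral>x. u x \<bullet> (B x *v u x) \<partial>M))
    \<le> (\<integral>\<^sup>+x. ennreal (g x \<bullet> (matrix_inv (B x) *v g x)) \<partial>M)" (is "_ \<le> ?\<sigma>")
proof (cases "?\<sigma> = \<infinity>")
  case True
  then show ?thesis by simp
next
  case False
  then obtain r where r: "0 \<le> r" "?\<sigma> = ennreal r"
    by (cases ?\<sigma>) auto
  define h where "h = (\<lambda>x. u x \<bullet> g x)"
  define k where "k = (\<lambda>x. u x \<bullet> (B x *v u x))"
  have [measurable]: "h \<in> borel_measurable M" "k \<in> borel_measurable M"
    using meas int by (auto simp: h_def k_def)
  have intk: "integrable M k"
    using int by (simp add: k_def)
  have young: "AE x in M. 2 * \<bar>h x\<bar> - k x \<le> g x \<bullet> (matrix_inv (B x) *v g x)"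
    using pd
  proof eventually_elim
    case (elim x)
    have "(- u x) \<bullet> (B x *v (- u x)) = u x \<bullet> (B x *v u x)"
      using matrix_vector_mult_diff_distrib[of "B x" 0 "u x"] by simp
    then show ?case
      using young_quadratic_form[OF elim, of "u x" "g x"]
        young_quadratic_form[OF elim, of "- u x" "g x"]
      by (auto simp: h_def k_def abs_if)
  qed
  \<comment> \<open>The dissipation density is not assumed measurable, so the integral is split off along the
    measurable lower bound \<open>2 \<bar>h\<bar> - k\<close> of that density.\<close>
  have "(\<integral>\<^sup>+x. ennreal (norm (h x)) \<partial>M)
      \<le> (\<integral>\<^sup>+x. ennreal (norm (k x)) + ennreal (2 * \<bar>h x\<bar> - k x) \<partial>M)"
  proof (rule nn_integral_mono)
    fix x
    have "ennreal (norm (h x)) \<le> ennreal (norm (k x) + max 0 (2 * \<bar>h x\<bar> - k x))"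
      by (rule ennreal_leI) auto
    also have "\<dots> = ennreal (norm (k x)) + ennreal (2 * \<bar>h x\<bar> - k x)"
      by (simp add: ennreal_plus max_def ennreal_neg)
    finally show "ennreal (norm (h x)) \<le> ennreal (norm (k x)) + ennreal (2 * \<bar>h x\<bar> - k x)" .
  qed
  also have "\<dots> = (\<integral>\<^sup>+x. ennreal (norm (k x)) \<partial>M) + (\<integral>\<^sup>+x. ennreal (2 * \<bar>h x\<bar> - k x) \<partial>M)"
    by (rule nn_integral_add) measurable
  also have "(\<integral>\<^sup>+x. ennreal (2 * \<bar>h x\<bar> - k x) \<partial>M) \<le> ?\<sigma>"
    using young by (intro nn_integral_mono_AE) (auto elim!: eventually_mono intro: ennreal_leI)
  also have "(\<integral>\<^sup>+x. ennreal (norm (k x)) \<partial>M) + ?\<sigma> < \<infinity>"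
    using intk False by (auto simp: integrable_iff_bounded less_top)
  finally have inth: "integrable M h"
    by (simp add: integrable_iff_bounded add_left_mono)
  have "(\<integral>\<^sup>+x. ennreal (2 * h x - k x) \<partial>M) \<le> ?\<sigma>"
  proof (rule nn_integral_mono_AE)
    show "AE x in M. ennreal (2 * h x - k x) \<le> ennreal (g x \<bullet> (matrix_inv (B x) *v g x))"
      using young by eventually_elim (intro ennreal_leI, auto)
  qed
  then have "(\<integral>x. 2 * h x - k x \<partial>M) \<le> r"
    using r by (intro integral_real_bounded) auto
  then show ?thesis
    using inth intk r by (simp add: h_def k_def ennreal_leI)
qed

text \<open>
  Every Lebesgue measurable function is an almost everywhere limit of continuous functions; composing
  these with the projection onto the ball preserves the bound.
\<close>

lemma bounded_borel_ae_limit_of_continuous: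
  fixes f :: "'a::euclidean_space \<Rightarrow> 'b::euclidean_space"
  assumes "f \<in> borel_measurable borel" and bound: "\<And>x. norm (f x) \<le> R"
  obtains h where "\<And>k::nat. continuous_on UNIV (h k)" "\<And>k x. norm (h k x) \<le> R"
    "AE x in lborel. (\<lambda>k. h k x) \<longlonglongrightarrow> f x"
proof -
  have "f measurable_on UNIV"
    using assms(1) by (intro lebesgue_measurable_imp_measurable_on measurable_completion) auto
  then obtain N h where N: "negligible N" and h: "\<And>k::nat. continuous_on UNIV (h k)"
    and lim: "\<And>x. x \<notin> N \<Longrightarrow> (\<lambda>k. h k x) \<longlonglongrightarrow> f x"
    unfolding measurable_on_def by auto
  have "0 \<le> R"
    using bound order_trans norm_ge_zero by blast
  then have ball: "convex (cball (0::'b) R)" "closed (cball (0::'b) R)" "cball (0::'b) R \<noteq> {}"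
    by auto
  let ?p = "closest_point (cball (0::'b) R)"
  show ?thesis
  proof
    show "continuous_on UNIV (\<lambda>x. ?p (h k x))" for k
      by (rule continuous_on_compose2[OF continuous_on_closest_point[OF ball, of UNIV] h]) auto
    show "norm (?p (h k x)) \<le> R" for k x
      using closest_point_in_set[OF ball(2,3), of "h k x"] by simp
    have "AE x in lebesgue. (\<lambda>k. ?p (h k x)) \<longlonglongrightarrow> f x"
    proof (rule AE_I')
      show "N \<in> null_sets lebesgue"
        using N by (simp add: negligible_iff_null_sets)
      have "(\<lambda>k. ?p (h k x)) \<longlonglongrightarrow> ?p (f x)" if "x \<notin> N" for x
        using continuous_at_closest_point[OF ball] lim[OF that] by (rule isCont_tendsto_compose)
      moreover have "?p (f x) = f x" for x
        using bound by (intro closest_point_self) simp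
      ultimately show "{x \<in> space lebesgue. \<not> (\<lambda>k. ?p (h k x)) \<longlonglongrightarrow> f x} \<subseteq> N"
        by auto
    qed
    then show "AE x in lborel. (\<lambda>k. ?p (h k x)) \<longlonglongrightarrow> f x"
      by (simp add: AE_completion_iff)
  qed
qed

text \<open>
  The converse of the variational bound: it is enough to test with bounded continuous fields. The
  optimal field \<open>B\<^sup>-\<^sup>1 g\<close> is neither bounded nor continuous, so it is cut off where its norm exceeds
  \<open>n\<close> and the cut-off field is approximated by bounded continuous ones. Dominated convergence carries
  the bound \<open>L\<close> to the cut-off fields, and monotone convergence in \<open>n\<close> to \<open>B\<^sup>-\<^sup>1 g\<close>. Absolute continuity
  of \<open>M\<close> turns approximation Lebesgue almost everywhere into approximation \<open>M\<close>-almost everywhere, and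
  Cramer's rule provides a measurable version of \<open>B\<^sup>-\<^sup>1 g\<close>.
\<close>

lemma variational_formula_continuous_tests:
  fixes M :: "(real^'n) measure" and g :: "real^'n \<Rightarrow> real^'n" and B :: "real^'n \<Rightarrow> real^'n^'n"
  assumes sets: "sets M = sets (restrict_space borel X)" and X: "X \<in> sets borel"
    and ac: "\<And>P. (AE x in lborel. P x) \<Longrightarrow> AE x in M. P x"
    and g: "integrable M g" and B: "integrable M B"
    and pd: "AE x in M. positive_definite (B x)"
    and test: "\<And>\<xi>. continuous_on UNIV \<xi> \<Longrightarrow> bounded (range \<xi>) \<Longrightarrow>
      ennreal (2 * (\<integral>x. \<xi> x \<bullet> g x \<partial>M) - (\<integral>x. \<xi> x \<bullet> (B x *v \<xi> x) \<partial>M)) \<le> L"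
  shows "(\<integral>\<^sup>+x. ennreal (g x \<bullet> (matrix_inv (B x) *v g x)) \<partial>M) \<le> L"
proof -
  define w :: "real^'n \<Rightarrow> real^'n" where
    "w x = (\<chi> k. det (\<chi> i j. if j = k then g x $ i else B x $ i $ j) / det (B x))" for x
  have [measurable]: "g \<in> borel_measurable M" "B \<in> borel_measurable M"
    using g B by auto
  have entry[measurable]: "(\<lambda>x. g x $ i) \<in> borel_measurable M" "(\<lambda>x. B x $ i $ j) \<in> borel_measurable M" for i j
    by (intro borel_measurable_nth_field; simp)+
  have w[measurable]: "w \<in> borel_measurable M"
  proof (rule borel_measurable_vec_field)
    fix i
    have "(\<lambda>x. if b then g x $ c else B x $ c $ d) \<in> borel_measurable M" for b c d
      by (cases b) (simp_all add: entry)
    then have numerator: "(\<lambda>x. (\<chi> c d. if d = i then g x $ c else B x $ c $ d) $ c $ d) \<in> borel_measurable M"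
      for c d
      by simp
    have "(\<lambda>x. det (\<chi> c d. if d = i then g x $ c else B x $ c $ d) / det (B x)) \<in> borel_measurable M"
      by (rule borel_measurable_divide[OF borel_measurable_det[OF numerator] borel_measurable_det[OF entry(2)]])
    then show "(\<lambda>x. w x $ i) \<in> borel_measurable M"
      by (simp add: w_def)
  qed
  have opt: "AE x in M. w x = matrix_inv (B x) *v g x \<and> B x *v w x = g x \<and> 0 \<le> w x \<bullet> g x"
    using pd
  proof eventually_elim
    case (elim x)
    have inv: "B x *v (matrix_inv (B x) *v g x) = g x"
      by (simp add: elim positive_definite_invertible invertible_matrix_inv_solves)
    have "det (B x) \<noteq> 0"
      using elim positive_definite_invertible invertible_det_nz by blast
    then have eq: "w x = matrix_inv (B x) *v g x"
      unfolding w_def using inv by (subst (asm) cramer) (assumption, rule sym)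
    then have "0 \<le> w x \<bullet> (B x *v w x)"
      using elim unfolding positive_definite_def by (metis inner_zero_left less_eq_real_def)
    then show ?case
      using eq inv by auto
  qed
  then have w_solves: "AE x in M. B x *v w x = g x" and w_nonneg: "AE x in M. 0 \<le> w x \<bullet> g x"
    by (auto elim: eventually_mono)
  have space: "space M = X"
    using sets_eq_imp_space_eq[OF sets] by (simp add: space_restrict_space)
  define F where "F n x = ennreal (if norm (w x) \<le> real n then w x \<bullet> g x else 0)" for n x
  have le_L: "(\<integral>\<^sup>+x. F n x \<partial>M) \<le> L" for n
  proof -
    define c where "c x = (if norm (w x) \<le> real n then w x else 0)" for x
    have c[measurable]: "c \<in> borel_measurable M"
      unfolding c_def by measurable
    have cbound: "norm (c x) \<le> real n" for x
      by (simp add: c_def)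
    have "c \<in> borel_measurable (restrict_space borel X)"
      using c by (simp only: measurable_cong_sets[OF sets refl])
    then have cX: "(\<lambda>x. indicator X x *\<^sub>R c x) \<in> borel_measurable borel"
      by (rule iffD1[OF borel_measurable_restrict_space_iff, rotated]) (simp add: X)
    have cX_bound: "norm (indicator X x *\<^sub>R c x) \<le> real n" for x
      using cbound by (simp add: indicator_def)
    obtain h where h: "\<And>k::nat. continuous_on UNIV (h k)" "\<And>k x. norm (h k x) \<le> real n"
      and lim: "AE x in lborel. (\<lambda>k. h k x) \<longlonglongrightarrow> indicator X x *\<^sub>R c x"
      using bounded_borel_ae_limit_of_continuous[OF cX cX_bound] by blast
    have limM: "AE x in M. (\<lambda>k. h k x) \<longlonglongrightarrow> c x"
      using ac[OF lim] AE_space[of M] by eventually_elim (simp add: space)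
    have hM[measurable]: "h k \<in> borel_measurable M" for k
      using borel_measurable_continuous_on_restrict[OF continuous_on_subset[OF h(1)], of X k]
        measurable_cong_sets[OF sets refl, of borel]
      by auto
    have lim1: "(\<lambda>k. \<integral>x. h k x \<bullet> g x \<partial>M) \<longlonglongrightarrow> (\<integral>x. c x \<bullet> g x \<partial>M)"
    proof (rule integral_dominated_convergence)
      show "integrable M (\<lambda>x. real n * norm (g x))"
        using g by simp
      show "AE x in M. (\<lambda>k. h k x \<bullet> g x) \<longlonglongrightarrow> c x \<bullet> g x"
        using limM by eventually_elim (intro tendsto_intros)
      show "AE x in M. norm (h k x \<bullet> g x) \<le> real n * norm (g x)" for k
        using h(2)
        by (intro AE_I2) (auto intro!: order_trans[OF Cauchy_Schwarz_ineq2] mult_right_mono)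
    qed measurable
    have lim2: "(\<lambda>k. \<integral>x. h k x \<bullet> (B x *v h k x) \<partial>M) \<longlonglongrightarrow> (\<integral>x. c x \<bullet> (B x *v c x) \<partial>M)"
    proof (rule integral_dominated_convergence)
      show "integrable M (\<lambda>x. real CARD('n) * real CARD('n) * (real n * real n * norm (B x)))"
        using B by simp
      show "AE x in M. (\<lambda>k. h k x \<bullet> (B x *v h k x)) \<longlonglongrightarrow> c x \<bullet> (B x *v c x)"
        using limM by eventually_elim (unfold inner_matrix_vector_eq_sum, intro tendsto_intros)
      show "AE x in M. norm (h k x \<bullet> (B x *v h k x))
          \<le> real CARD('n) * real CARD('n) * (real n * real n * norm (B x))" for k
      proof (rule AE_I2)
        fix x
        have "norm (h k x) * norm (h k x) \<le> real n * real n"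
          using h(2) by (intro mult_mono) auto
        then have "real CARD('n) * real CARD('n) * (norm (h k x) * norm (h k x) * norm (B x))
            \<le> real CARD('n) * real CARD('n) * (real n * real n * norm (B x))"
          by (intro mult_left_mono mult_right_mono) auto
        then show "norm (h k x \<bullet> (B x *v h k x))
            \<le> real CARD('n) * real CARD('n) * (real n * real n * norm (B x))"
          unfolding real_norm_def by (rule order_trans[OF abs_inner_matrix_vector_le])
      qed
    qed (intro borel_measurable_inner_matrix_vector; measurable)+
    have nonneg: "AE x in M. 0 \<le> c x \<bullet> g x"
      using w_nonneg by eventually_elim (simp add: c_def)
    have "(\<integral>x. c x \<bullet> (B x *v c x) \<partial>M) = (\<integral>x. c x \<bullet> g x \<partial>M)"
    proof (rule integral_cong_AE)
      show "AE x in M. c x \<bullet> (B x *v c x) = c x \<bullet> g x"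
        using w_solves by eventually_elim (simp add: c_def)
      show "(\<lambda>x. c x \<bullet> (B x *v c x)) \<in> borel_measurable M"
        by (intro borel_measurable_inner_matrix_vector) measurable
    qed measurable
    then have "(\<lambda>k. 2 * (\<integral>x. h k x \<bullet> g x \<partial>M) - (\<integral>x. h k x \<bullet> (B x *v h k x) \<partial>M))
        \<longlonglongrightarrow> (\<integral>x. c x \<bullet> g x \<partial>M)"
      using tendsto_diff[OF tendsto_mult[OF tendsto_const[of 2] lim1] lim2] by simp
    then have "(\<lambda>k. ennreal (2 * (\<integral>x. h k x \<bullet> g x \<partial>M) - (\<integral>x. h k x \<bullet> (B x *v h k x) \<partial>M)))
        \<longlonglongrightarrow> ennreal (\<integral>x. c x \<bullet> g x \<partial>M)"
      by (rule tendsto_ennrealI)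
    then have "ennreal (\<integral>x. c x \<bullet> g x \<partial>M) \<le> L"
    proof (rule LIMSEQ_le_const2, intro exI allI impI)
      fix k
      show "ennreal (2 * (\<integral>x. h k x \<bullet> g x \<partial>M) - (\<integral>x. h k x \<bullet> (B x *v h k x) \<partial>M)) \<le> L"
        using h(2) by (intro test h(1)) (auto simp: bounded_iff)
    qed
    also have "ennreal (\<integral>x. c x \<bullet> g x \<partial>M) = (\<integral>\<^sup>+x. ennreal (c x \<bullet> g x) \<partial>M)"
      using nonneg g cbound
      by (intro nn_integral_eq_integral[symmetric] integrable_inner_bounded[of _ _ _ "real n"]) auto
    also have "\<dots> = (\<integral>\<^sup>+x. F n x \<partial>M)"
      by (intro nn_integral_cong) (simp add: F_def c_def)
    finally show ?thesis .
  qed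
  have "(\<integral>\<^sup>+x. ennreal (g x \<bullet> (matrix_inv (B x) *v g x)) \<partial>M) = (\<integral>\<^sup>+x. (SUP n. F n x) \<partial>M)"
  proof (rule nn_integral_cong_AE)
    show "AE x in M. ennreal (g x \<bullet> (matrix_inv (B x) *v g x)) = (SUP n. F n x)"
      using opt
    proof eventually_elim
      case (elim x)
      have "(SUP n. F n x) = ennreal (w x \<bullet> g x)"
      proof (rule antisym)
        show "(SUP n. F n x) \<le> ennreal (w x \<bullet> g x)"
          by (rule SUP_least) (simp add: F_def)
        obtain n where "norm (w x) \<le> real n"
          using real_arch_simple by blast
        then have "F n x = ennreal (w x \<bullet> g x)"
          by (simp add: F_def)
        then show "ennreal (w x \<bullet> g x) \<le> (SUP n. F n x)"
          by (metis SUP_upper UNIV_I)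
      qed
      then show ?case
        using elim by (simp add: inner_commute)
    qed
  qed
  also have "\<dots> = (SUP n. \<integral>\<^sup>+x. F n x \<partial>M)"
  proof (rule nn_integral_monotone_convergence_SUP)
    show "incseq F"
      by (auto simp: incseq_def le_fun_def F_def ennreal_neg)
    show "F n \<in> borel_measurable M" for n
      unfolding F_def by measurable
  qed
  also have "\<dots> \<le> L"
    by (rule SUP_least) (rule le_L)
  finally show ?thesis .
qed

section \<open>Coefficients of a diffusion semigroup\<close>

context diffusion_semigroup
begin

lemma sets_pi: "sets \<pi> = sets (restrict_space borel X)"
  using invariant by (simp add: invariant_prob_def)

lemma AE_pi_if_AE_lborel:
  assumes X: "open X" and p: "AE x in lborel. x \<in> X \<longrightarrow> p x"
  shows "AE x in \<pi>. p x"
proof -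
  have "Linf_loc X V"
    using V_W2 by (simp add: numeral_2_eq_2)
  then have "V \<in> borel_measurable (restrict_space borel X)"
    by (simp add: Linf_loc_def)
  then have [measurable]: "V \<in> borel_measurable (restrict_space lborel X)"
    using measurable_cong_sets[OF sets_restrict_space_cong[OF sets_lborel] refl] by blast
  have "AE x in restrict_space lborel X. p x"
    using p X by (subst AE_restrict_space_iff) auto
  then show ?thesis
    unfolding density_pi by (subst AE_density) auto
qed

text \<open>Ellipticity on each set of a countable exhaustion by compact sets suffices.\<close>

lemma AE_pi_positive_definite:
  assumes X: "open X"
  shows "AE x in \<pi>. positive_definite (A x)"
proof -
  obtain C where C: "\<And>n::nat. compact (C n)" "\<And>n. C n \<subseteq> X" "\<Union>(range C) = X"
    using open_Union_compact_subsets[OF X] by metis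
  have "AE x in lborel. x \<in> C n \<longrightarrow> (\<forall>v. v \<noteq> 0 \<longrightarrow> 0 < v \<bullet> (A x *v v))" for n
  proof -
    obtain c where c: "c > 0"
      and ae: "AE x in lborel. x \<in> C n \<longrightarrow> (\<forall>v. c * (v \<bullet> v) \<le> v \<bullet> (A x *v v))"
      using A_elliptic[OF C(1,2)] by blast
    show ?thesis
      using ae
    proof eventually_elim
      case (elim x)
      show ?case
      proof (intro impI allI)
        fix v :: "real^'d" assume "x \<in> C n" "v \<noteq> 0"
        then have "0 < c * (v \<bullet> v)" "c * (v \<bullet> v) \<le> v \<bullet> (A x *v v)"
          using c elim by auto
        then show "0 < v \<bullet> (A x *v v)" by linarith
      qed
    qed
  qed
  then have "AE x in lborel. \<forall>n. x \<in> C n \<longrightarrow> (\<forall>v. v \<noteq> 0 \<longrightarrow> 0 < v \<bullet> (A x *v v))"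
    unfolding AE_all_countable by blast
  then have "AE x in lborel. x \<in> X \<longrightarrow> positive_definite (A x)"
    using A_symmetric
    by eventually_elim (use C(3) in \<open>auto simp: positive_definite_def\<close>)
  then show ?thesis
    by (rule AE_pi_if_AE_lborel[OF X])
qed

lemma borel_measurable_gamma: "\<gamma> \<in> borel_measurable \<pi>"
proof (rule borel_measurable_vec_field)
  fix i
  have "Linf_loc X (\<lambda>x. \<gamma> x $ i)"
    using gamma_W1[of i] by simp
  then show "(\<lambda>x. \<gamma> x $ i) \<in> borel_measurable \<pi>"
    using measurable_cong_sets[OF sets_pi refl] by (auto simp: Linf_loc_def)
qed

end

section \<open>Push-forward of matrix-valued measures\<close>

lemma bounded_linear_quadratic_form: "bounded_linear (\<lambda>M::real^'n^'n. v \<bullet> (M *v v))"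
  unfolding linear_conv_bounded_linear[symmetric]
  by (rule linearI)
    (simp_all add: matrix_vector_mult_add_rdistrib inner_add_right scaleR_matrix_vector_assoc[symmetric])

lemma sets_quad_measure: "sets (quad_measure X Q v) = sets (restrict_space borel X)"
  unfolding quad_measure_def
  using sets.space_closed[of "restrict_space borel X"]
    sets.sigma_sets_eq[of "restrict_space borel X"]
  by (simp add: space_restrict_space)

text \<open>
  A set function that is not a measure generates the zero measure by convention; positivity and
  countable additivity of \<open>Q\<close> ensure that \<open>v \<bullet> Q v\<close> is a measure, so its values are retained.
\<close>

lemma emeasure_quad_measure:
  assumes Q: "psd_measure X Q" and S: "S \<in> sets (restrict_space borel X)"
  shows "emeasure (quad_measure X Q v) S = ennreal (v \<bullet> (Q S *v v))"
proof (rule emeasure_measure_of[OF quad_measure_def])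
  note sets = sets_quad_measure[of X Q v]
  show "sets (restrict_space borel X) \<subseteq> Pow X"
    using sets.space_closed[of "restrict_space borel X"] by (simp add: space_restrict_space)
  show "S \<in> sets (quad_measure X Q v)"
    using S sets by simp
  interpret q: bounded_linear "\<lambda>M::real^'b^'b. v \<bullet> (M *v v)"
    by (rule bounded_linear_quadratic_form)
  have nonneg: "0 \<le> v \<bullet> (Q B *v v)" if "B \<in> sets (restrict_space borel X)" for B
    using Q that by (auto simp: psd_measure_def psd_def)
  have add: "(\<lambda>k. Q (B k)) sums Q (\<Union>k. B k)"
    if "range B \<subseteq> sets (restrict_space borel X)" "disjoint_family B" for B :: "nat \<Rightarrow> _"
    using Q that by (auto simp: psd_measure_def)
  have "(\<lambda>_::nat. Q {}) sums Q {}"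
    using add[of "\<lambda>_. {}"] by (simp add: disjoint_family_on_def)
  then have "Q {} = 0"
    using sums_summable summable_const_iff by blast
  then show "positive (sets (quad_measure X Q v)) (\<lambda>B. ennreal (v \<bullet> (Q B *v v)))"
    by (simp add: positive_def)
  show "countably_additive (sets (quad_measure X Q v)) (\<lambda>B. ennreal (v \<bullet> (Q B *v v)))"
    unfolding countably_additive_def sets
  proof (intro allI impI)
    fix B :: "nat \<Rightarrow> _"
    assume B: "range B \<subseteq> sets (restrict_space borel X)" "disjoint_family B"
    have "(\<lambda>k. v \<bullet> (Q (B k) *v v)) sums (v \<bullet> (Q (\<Union>k. B k) *v v))"
      using q.sums[OF add[OF B]] .
    then show "(\<Sum>k. ennreal (v \<bullet> (Q (B k) *v v))) = ennreal (v \<bullet> (Q (\<Union>k. B k) *v v))"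
      using nonneg B(1) by (subst suminf_ennreal2) (auto simp: sums_iff)
  qed
qed

text \<open>
  The condition \<open>\<Phi>\<^sub># Q = B \<mu>\<close> on matrix-valued measures gives \<open>\<Phi>\<^sub># (v \<bullet> Q v) = (v \<bullet> B v) \<mu>\<close> for each of
  the positive measures by which integrals against \<open>Q\<close> are defined.
\<close>

lemma distr_quad_measure:
  fixes E :: "(real^'m) set" and \<mu> :: "(real^'n) measure" and \<Phi> :: "real^'m \<Rightarrow> real^'n"
  assumes Q: "psd_measure E Q"
    and push: "\<And>S. S \<in> sets (restrict_space borel F) \<Longrightarrow>
      Q (\<Phi> -` S \<inter> E) = (LINT y:S|\<mu>. B y)"
    and \<Phi>: "\<Phi> \<in> restrict_space borel E \<rightarrow>\<^sub>M restrict_space borel F"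
    and sets: "sets \<mu> = sets (restrict_space borel F)"
    and B: "integrable \<mu> B" and pd: "AE y in \<mu>. positive_definite (B y)"
  shows "distr (quad_measure E Q v) \<mu> \<Phi> = density \<mu> (\<lambda>y. ennreal (v \<bullet> (B y *v v)))"
proof (rule measure_eqI)
  show "sets (distr (quad_measure E Q v) \<mu> \<Phi>) = sets (density \<mu> (\<lambda>y. ennreal (v \<bullet> (B y *v v))))"
    by simp
  fix S assume "S \<in> sets (distr (quad_measure E Q v) \<mu> \<Phi>)"
  then have S: "S \<in> sets \<mu>" by simp
  then have S': "S \<in> sets (restrict_space borel F)" using sets by simp
  have \<Phi>q: "\<Phi> \<in> quad_measure E Q v \<rightarrow>\<^sub>M \<mu>"
    using \<Phi> measurable_cong_sets[OF sets_quad_measure sets] by blast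
  have spc: "space (quad_measure E Q v) = E"
    using sets_eq_imp_space_eq[OF sets_quad_measure] by (simp add: space_restrict_space)
  have pre: "\<Phi> -` S \<inter> E \<in> sets (restrict_space borel E)"
    using measurable_sets[OF \<Phi> S'] by (simp add: space_restrict_space)
  have nonneg: "AE y in \<mu>. 0 \<le> v \<bullet> (B y *v v)"
    using pd by eventually_elim
      (metis positive_definite_def inner_zero_left less_eq_real_def)
  have int: "integrable \<mu> (\<lambda>y. v \<bullet> (B y *v v))"
    by (rule integrable_bounded_linear[OF bounded_linear_quadratic_form B])
  have intS: "integrable \<mu> (\<lambda>y. indicator S y *\<^sub>R B y)"
    using S B by (rule integrable_mult_indicator)
  have "v \<bullet> (Q (\<Phi> -` S \<inter> E) *v v) = (\<integral>y. v \<bullet> ((indicator S y *\<^sub>R B y) *v v) \<partial>\<mu>)"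
    unfolding push[OF S'] set_lebesgue_integral_def
    by (rule integral_bounded_linear[OF bounded_linear_quadratic_form intS, symmetric])
  also have "ennreal \<dots> = (\<integral>\<^sup>+y. ennreal (v \<bullet> ((indicator S y *\<^sub>R B y) *v v)) \<partial>\<mu>)"
  proof (rule nn_integral_eq_integral[symmetric])
    show "integrable \<mu> (\<lambda>y. v \<bullet> ((indicator S y *\<^sub>R B y) *v v))"
      by (rule integrable_bounded_linear[OF bounded_linear_quadratic_form intS])
    show "AE y in \<mu>. 0 \<le> v \<bullet> ((indicator S y *\<^sub>R B y) *v v)"
      using nonneg by eventually_elim (simp add: indicator_def)
  qed
  also have "\<dots> = (\<integral>\<^sup>+y. ennreal (v \<bullet> (B y *v v)) * indicator S y \<partial>\<mu>)"
    by (rule nn_integral_cong) (simp add: indicator_def)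
  also have "\<dots> = emeasure (density \<mu> (\<lambda>y. ennreal (v \<bullet> (B y *v v)))) S"
    using S int by (subst emeasure_density) auto
  finally have "ennreal (v \<bullet> (Q (\<Phi> -` S \<inter> E) *v v))
      = emeasure (density \<mu> (\<lambda>y. ennreal (v \<bullet> (B y *v v)))) S" .
  then show "emeasure (distr (quad_measure E Q v) \<mu> \<Phi>) S
      = emeasure (density \<mu> (\<lambda>y. ennreal (v \<bullet> (B y *v v)))) S"
    by (simp add: emeasure_distr[OF \<Phi>q S] spc emeasure_quad_measure[OF Q pre])
qed

text \<open>
  The weight \<open>\<xi> \<xi>\<^sup>T \<circ> \<Phi>\<close> is the one for which the trace integral is a quadratic form in \<open>\<xi>\<close>, and it depends
  on the point of \<open>E\<close> only through \<open>\<Phi>\<close>, so that \<open>Q\<close> may be replaced by its push-forward.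
\<close>

lemma trace_integral_rank_one_pushforward:
  fixes E :: "(real^'m) set" and \<mu> :: "(real^'n) measure" and \<Phi> :: "real^'m \<Rightarrow> real^'n"
    and \<xi> :: "real^'n \<Rightarrow> real^'n"
  assumes Q: "psd_measure E Q"
    and push: "\<And>S. S \<in> sets (restrict_space borel F) \<Longrightarrow>
      Q (\<Phi> -` S \<inter> E) = (LINT y:S|\<mu>. B y)"
    and \<Phi>: "\<Phi> \<in> restrict_space borel E \<rightarrow>\<^sub>M restrict_space borel F"
    and sets: "sets \<mu> = sets (restrict_space borel F)"
    and B: "integrable \<mu> B" and pd: "AE y in \<mu>. positive_definite (B y)"
    and \<xi>[measurable]: "\<xi> \<in> borel_measurable \<mu>" and bound: "\<And>y. norm (\<xi> y) \<le> R"
  shows "trace_integral E Q (\<lambda>z. \<chi> i j. \<xi> (\<Phi> z) $ i * \<xi> (\<Phi> z) $ j)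
    = (\<integral>y. \<xi> y \<bullet> (B y *v \<xi> y) \<partial>\<mu>)"
proof -
  have [measurable]: "B \<in> borel_measurable \<mu>"
    using B by auto
  have [measurable]: "(\<lambda>y. \<xi> y $ i) \<in> borel_measurable \<mu>" for i
    by (intro borel_measurable_nth_field) simp
  have int: "integrable \<mu> (\<lambda>y. (\<xi> y $ i * \<xi> y $ j) * (u \<bullet> (B y *v v)))" for i j u v
  proof -
    have "integrable \<mu> (\<lambda>y. ((\<xi> y $ i * \<xi> y $ j) *\<^sub>R u) \<bullet> (B y *v v))"
    proof (rule integrable_inner_matrix_vector[where R = "R * R * norm u" and S = "norm v", OF _ _ B])
      fix y
      have "\<bar>\<xi> y $ i\<bar> * \<bar>\<xi> y $ j\<bar> \<le> R * R"
        using order_trans[OF component_le_norm_cart bound] order_trans[OF norm_ge_zero bound]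
        by (intro mult_mono) auto
      then show "norm ((\<xi> y $ i * \<xi> y $ j) *\<^sub>R u) \<le> R * R * norm u"
        by (simp add: abs_mult mult_right_mono)
    qed auto
    then show ?thesis by simp
  qed
  have int_entry: "integrable \<mu> (\<lambda>y. \<xi> y $ i * \<xi> y $ j * B y $ i $ j)" for i j
    using int[of i j "axis i 1" "axis j 1"]
    by (simp add: matrix_vector_mult_basis inner_axis' column_def)
  have quad: "(\<integral>z. \<xi> (\<Phi> z) $ i * \<xi> (\<Phi> z) $ j \<partial>quad_measure E Q v)
      = (\<integral>y. (\<xi> y $ i * \<xi> y $ j) * (v \<bullet> (B y *v v)) \<partial>\<mu>)" for i j v
  proof -
    have \<Phi>q: "\<Phi> \<in> quad_measure E Q v \<rightarrow>\<^sub>M \<mu>"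
      using \<Phi> measurable_cong_sets[OF sets_quad_measure sets] by blast
    have "(\<integral>z. \<xi> (\<Phi> z) $ i * \<xi> (\<Phi> z) $ j \<partial>quad_measure E Q v)
        = (\<integral>y. \<xi> y $ i * \<xi> y $ j \<partial>distr (quad_measure E Q v) \<mu> \<Phi>)"
      by (rule integral_distr[OF \<Phi>q, symmetric]) measurable
    also have "\<dots> = (\<integral>y. \<xi> y $ i * \<xi> y $ j \<partial>density \<mu> (\<lambda>y. ennreal (v \<bullet> (B y *v v))))"
      by (simp only: distr_quad_measure[OF Q push \<Phi> sets B pd])
    also have "\<dots> = (\<integral>y. (v \<bullet> (B y *v v)) *\<^sub>R (\<xi> y $ i * \<xi> y $ j) \<partial>\<mu>)"
    proof (rule integral_density)
      show "AE y in \<mu>. 0 \<le> v \<bullet> (B y *v v)"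
        using pd by eventually_elim
          (metis positive_definite_def inner_zero_left less_eq_real_def)
      show "(\<lambda>y. v \<bullet> (B y *v v)) \<in> borel_measurable \<mu>"
        by (intro borel_measurable_inner_matrix_vector) measurable
    qed measurable
    finally show ?thesis
      by (simp add: mult_ac)
  qed
  have entry: "entry_integral E Q j i (\<lambda>z. \<xi> (\<Phi> z) $ i * \<xi> (\<Phi> z) $ j)
      = (\<integral>y. \<xi> y $ i * \<xi> y $ j * B y $ i $ j \<partial>\<mu>)" for i j
  proof -
    let ?p = "axis j 1 + axis i 1 :: real^'n" and ?m = "axis j 1 - axis i 1 :: real^'n"
    have "entry_integral E Q j i (\<lambda>z. \<xi> (\<Phi> z) $ i * \<xi> (\<Phi> z) $ j)
        = (\<integral>y. ((\<xi> y $ i * \<xi> y $ j) * (?p \<bullet> (B y *v ?p))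
            - (\<xi> y $ i * \<xi> y $ j) * (?m \<bullet> (B y *v ?m))) / 4 \<partial>\<mu>)"
      unfolding entry_integral_def quad by (simp add: int)
    also have "\<dots> = (\<integral>y. \<xi> y $ i * \<xi> y $ j * B y $ i $ j \<partial>\<mu>)"
    proof (rule integral_cong_AE)
      \<comment> \<open>Polarization returns the symmetric part of \<open>B y\<close>, which is \<open>B y\<close> itself almost everywhere.\<close>
      show "AE y in \<mu>. ((\<xi> y $ i * \<xi> y $ j) * (?p \<bullet> (B y *v ?p))
            - (\<xi> y $ i * \<xi> y $ j) * (?m \<bullet> (B y *v ?m))) / 4 = \<xi> y $ i * \<xi> y $ j * B y $ i $ j"
        using pd
      proof eventually_elim
        case (elim y)
        have "B y $ j $ i = B y $ i $ j"
          using elim unfolding positive_definite_def by (simp add: transpose_def vec_eq_iff)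
        then show ?case
          by (simp add: matrix_vector_mult_diff_distrib inner_add_left inner_diff_left
              matrix_vector_right_distrib matrix_vector_mult_basis inner_axis' column_def
              left_diff_distrib right_diff_distrib distrib_left distrib_right)
      qed
    qed (use int int_entry in auto)
    finally show ?thesis .
  qed
  show ?thesis
    unfolding inner_matrix_vector_eq_sum trace_integral_def
    by (simp add: entry int_entry)
qed

section \<open>Lower semicontinuity\<close>

theorem corollary1:
  fixes E :: "(real^'m) set" and Eb :: "(real^'n) set"
    and \<Phi> :: "real^'m \<Rightarrow> real^'n"
    and P :: "real \<Rightarrow> real \<Rightarrow> (real^'m \<Rightarrow> real) \<Rightarrow> (real^'m \<Rightarrow> real)"
    and \<pi> :: "real \<Rightarrow> (real^'m) measure"
    and V :: "real \<Rightarrow> real^'m \<Rightarrow> real"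
    and A :: "real \<Rightarrow> real^'m \<Rightarrow> real^'m^'m"
    and \<gamma> :: "real \<Rightarrow> real^'m \<Rightarrow> real^'m"
    and Pb :: "real \<Rightarrow> (real^'n \<Rightarrow> real) \<Rightarrow> (real^'n \<Rightarrow> real)"
    and \<pi>b :: "(real^'n) measure"
    and Vb :: "real^'n \<Rightarrow> real"
    and Ab :: "real^'n \<Rightarrow> real^'n^'n"
    and \<gamma>b :: "real^'n \<Rightarrow> real^'n"
  assumes "open E" "connected E" "open Eb" "connected Eb"
    and "C1_on E \<Phi>" "\<Phi> ` E = Eb"
    and "\<And>z. z \<in> E \<Longrightarrow> rank (jacobian \<Phi> (at z)) = CARD('n)"
    and "\<And>\<epsilon>. 0 < \<epsilon> \<Longrightarrow> diffusion_semigroup E (P \<epsilon>) (\<pi> \<epsilon>) (V \<epsilon>) (A \<epsilon>) (\<gamma> \<epsilon>)"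
    and "diffusion_semigroup Eb Pb \<pi>b Vb Ab \<gamma>b"
    and "coefficient_convergence E Eb \<Phi> \<pi> A \<gamma> \<pi>b Ab \<gamma>b"
  shows "Liminf (at_right 0) (\<lambda>\<epsilon>. sigma_hk_ss (A \<epsilon>) (\<gamma> \<epsilon>) (\<pi> \<epsilon>)) \<ge> sigma_hk_ss Ab \<gamma>b \<pi>b"
proof -
  note diffusion = assms(8) and macro = assms(9)
  define J where "J = (\<lambda>z. jacobian \<Phi> (at z))"
  define D where "D = (\<lambda>\<epsilon> z. J z ** A \<epsilon> z ** transpose (J z))"
  obtain \<epsilon>0 Q where \<epsilon>0: "\<epsilon>0 > 0"
    and gb: "integrable \<pi>b \<gamma>b" and Ab: "integrable \<pi>b Ab"
    and flux: "\<And>\<xi>. \<xi> \<in> Cb Eb \<Longrightarrow> ((\<lambda>\<epsilon>. \<integral>z. \<xi> (\<Phi> z) \<bullet> (J z *v \<gamma> \<epsilon> z) \<partial>\<pi> \<epsilon>)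
        \<longlongrightarrow> (\<integral>y. \<xi> y \<bullet> \<gamma>b y \<partial>\<pi>b)) (at_right 0)"
    and D: "\<And>\<epsilon>. 0 < \<epsilon> \<Longrightarrow> \<epsilon> < \<epsilon>0 \<Longrightarrow> integrable (\<pi> \<epsilon>) (D \<epsilon>)"
    and Q: "psd_measure E Q"
    and diff: "\<And>\<eta>. \<eta> \<in> Cb E \<Longrightarrow> (\<forall>z\<in>E. psd (\<eta> z)) \<Longrightarrow>
        ((\<lambda>\<epsilon>. \<integral>z. trace (\<eta> z ** D \<epsilon> z) \<partial>\<pi> \<epsilon>) \<longlongrightarrow> trace_integral E Q \<eta>) (at_right 0)"
    and push: "\<And>S. S \<in> sets (restrict_space borel Eb) \<Longrightarrow> Q (\<Phi> -` S \<inter> E) = (LINT y:S|\<pi>b. Ab y)"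
    using assms(10) unfolding coefficient_convergence_def Let_def J_def D_def by blast
  have sets_b: "sets \<pi>b = sets (restrict_space borel Eb)"
    by (rule diffusion_semigroup.sets_pi[OF macro])
  have pd_b: "AE y in \<pi>b. positive_definite (Ab y)"
    by (rule diffusion_semigroup.AE_pi_positive_definite[OF macro assms(3)])
  have J_cont: "continuous_on E J" and \<Phi>_cont: "continuous_on E \<Phi>"
    using assms(5) unfolding C1_on_def J_def
    by (auto intro!: continuous_at_imp_continuous_on differentiable_imp_continuous_within)
  have \<Phi>_meas: "\<Phi> \<in> restrict_space borel E \<rightarrow>\<^sub>M restrict_space borel Eb"
    using borel_measurable_continuous_on_restrict[OF \<Phi>_cont] assms(6)
    by (intro measurable_restrict_space2) (auto simp: space_restrict_space)
  have bound: "ennreal (2 * (\<integral>y. \<xi> y \<bullet> \<gamma>b y \<partial>\<pi>b) - (\<integral>y. \<xi> y \<bullet> (Ab y *v \<xi> y) \<partial>\<pi>b))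
      \<le> Liminf (at_right 0) (\<lambda>\<epsilon>. sigma_hk_ss (A \<epsilon>) (\<gamma> \<epsilon>) (\<pi> \<epsilon>))"
    if \<xi>: "continuous_on UNIV \<xi>" "bounded (range \<xi>)" for \<xi>
  proof -
    obtain R where R: "\<And>y. norm (\<xi> y) \<le> R"
      using \<xi>(2) by (auto simp: bounded_iff)
    have \<xi>\<Phi>_cont: "continuous_on E (\<lambda>z. \<xi> (\<Phi> z))"
      by (rule continuous_on_compose2[OF \<xi>(1) \<Phi>_cont]) simp
    define flux_\<epsilon> where "flux_\<epsilon> \<epsilon> = (\<integral>z. \<xi> (\<Phi> z) \<bullet> (J z *v \<gamma> \<epsilon> z) \<partial>\<pi> \<epsilon>)" for \<epsilon>
    define diff_\<epsilon> where "diff_\<epsilon> \<epsilon> = (\<integral>z. \<xi> (\<Phi> z) \<bullet> (D \<epsilon> z *v \<xi> (\<Phi> z)) \<partial>\<pi> \<epsilon>)" for \<epsilon>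
    define \<eta> :: "real^'m \<Rightarrow> real^'n^'n" where
      "\<eta> z = (\<chi> i j. \<xi> (\<Phi> z) $ i * \<xi> (\<Phi> z) $ j)" for z
    have lim_flux: "(flux_\<epsilon> \<longlongrightarrow> (\<integral>y. \<xi> y \<bullet> \<gamma>b y \<partial>\<pi>b)) (at_right 0)"
      unfolding flux_\<epsilon>_def
      by (rule flux) (use \<xi> in \<open>auto simp: Cb_def intro: continuous_on_subset bounded_subset\<close>)
    have lim_diff: "(diff_\<epsilon> \<longlongrightarrow> (\<integral>y. \<xi> y \<bullet> (Ab y *v \<xi> y) \<partial>\<pi>b)) (at_right 0)"
    proof -
      have \<xi>_meas: "\<xi> \<in> borel_measurable \<pi>b"
        using borel_measurable_continuous_on_restrict[OF continuous_on_subset[OF \<xi>(1)], of Eb]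
          measurable_cong_sets[OF sets_b refl, of borel] by auto
      have "continuous_on E \<eta>"
        unfolding \<eta>_def by (intro continuous_intros \<xi>\<Phi>_cont)
      moreover have "bounded (\<eta> ` E)"
      proof -
        let ?p = "\<lambda>v::real^'n. \<chi> i j. v $ i * v $ j"
        have "compact (?p ` cball 0 R)"
          by (intro compact_continuous_image continuous_intros) simp
        moreover have "\<eta> ` E \<subseteq> ?p ` cball 0 R"
          using R by (auto simp: \<eta>_def)
        ultimately show ?thesis
          using bounded_subset compact_imp_bounded by blast
      qed
      moreover have "psd (\<eta> z)" for z
      proof -
        have "v \<bullet> (\<eta> z *v v) = (v \<bullet> \<xi> (\<Phi> z))\<^sup>2" for v
          unfolding inner_matrix_vector_eq_sum
          by (simp add: \<eta>_def inner_vec_def power2_eq_square sum_product mult_ac)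
        then show ?thesis
          by (simp add: psd_def) (simp add: \<eta>_def transpose_def mult.commute)
      qed
      ultimately have "((\<lambda>\<epsilon>. \<integral>z. trace (\<eta> z ** D \<epsilon> z) \<partial>\<pi> \<epsilon>)
          \<longlongrightarrow> trace_integral E Q \<eta>) (at_right 0)"
        by (intro diff) (auto simp: Cb_def)
      moreover have "trace (\<eta> z ** D \<epsilon> z) = \<xi> (\<Phi> z) \<bullet> (D \<epsilon> z *v \<xi> (\<Phi> z))" for \<epsilon> z
        unfolding inner_matrix_vector_eq_sum
        by (subst sum.swap) (simp add: \<eta>_def trace_def matrix_matrix_mult_def mult_ac)
      moreover have "trace_integral E Q \<eta> = (\<integral>y. \<xi> y \<bullet> (Ab y *v \<xi> y) \<partial>\<pi>b)"
        unfolding \<eta>_def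
        by (rule trace_integral_rank_one_pushforward[OF Q push \<Phi>_meas sets_b Ab pd_b \<xi>_meas R])
      ultimately show ?thesis
        by (simp add: diff_\<epsilon>_def[abs_def])
    qed
    have le: "ennreal (2 * flux_\<epsilon> \<epsilon> - diff_\<epsilon> \<epsilon>) \<le> sigma_hk_ss (A \<epsilon>) (\<gamma> \<epsilon>) (\<pi> \<epsilon>)"
      if \<epsilon>: "0 < \<epsilon>" "\<epsilon> < \<epsilon>0" for \<epsilon>
    proof -
      note micro = diffusion[OF \<epsilon>(1)]
      have meas: "f \<in> borel_measurable (\<pi> \<epsilon>)" if "continuous_on E f"
        for f :: "real^'m \<Rightarrow> 'c::topological_space"
        using borel_measurable_continuous_on_restrict[OF that]
          measurable_cong_sets[OF diffusion_semigroup.sets_pi[OF micro] refl, of borel] by auto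
      define u where "u z = transpose (J z) *v \<xi> (\<Phi> z)" for z
      have u_gamma: "u z \<bullet> \<gamma> \<epsilon> z = \<xi> (\<Phi> z) \<bullet> (J z *v \<gamma> \<epsilon> z)" for z
        by (simp add: u_def dot_lmul_matrix)
      have u_A: "u z \<bullet> (A \<epsilon> z *v u z) = \<xi> (\<Phi> z) \<bullet> (D \<epsilon> z *v \<xi> (\<Phi> z))" for z
        unfolding D_def u_def matrix_vector_mul_assoc[symmetric]
        by (simp add: dot_lmul_matrix)
      have "ennreal (2 * (\<integral>z. u z \<bullet> \<gamma> \<epsilon> z \<partial>\<pi> \<epsilon>) - (\<integral>z. u z \<bullet> (A \<epsilon> z *v u z) \<partial>\<pi> \<epsilon>))
          \<le> (\<integral>\<^sup>+z. ennreal (\<gamma> \<epsilon> z \<bullet> (matrix_inv (A \<epsilon> z) *v \<gamma> \<epsilon> z)) \<partial>\<pi> \<epsilon>)"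
      proof (rule variational_lower_bound)
        show "AE z in \<pi> \<epsilon>. positive_definite (A \<epsilon> z)"
          by (rule diffusion_semigroup.AE_pi_positive_definite[OF micro assms(1)])
        show "(\<lambda>z. u z \<bullet> \<gamma> \<epsilon> z) \<in> borel_measurable (\<pi> \<epsilon>)"
          unfolding u_gamma
          by (intro borel_measurable_inner_matrix_vector meas \<xi>\<Phi>_cont J_cont
              diffusion_semigroup.borel_measurable_gamma[OF micro])
        show "integrable (\<pi> \<epsilon>) (\<lambda>z. u z \<bullet> (A \<epsilon> z *v u z))"
          unfolding u_A
          by (intro integrable_inner_matrix_vector[where R = R and S = R] meas \<xi>\<Phi>_cont D \<epsilon> R)
      qed
      then show ?thesis
        by (simp add: u_gamma u_A flux_\<epsilon>_def diff_\<epsilon>_def sigma_hk_ss_def)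
    qed
    have "((\<lambda>\<epsilon>. ennreal (2 * flux_\<epsilon> \<epsilon> - diff_\<epsilon> \<epsilon>)) \<longlongrightarrow>
        ennreal (2 * (\<integral>y. \<xi> y \<bullet> \<gamma>b y \<partial>\<pi>b) - (\<integral>y. \<xi> y \<bullet> (Ab y *v \<xi> y) \<partial>\<pi>b))) (at_right 0)"
      by (intro tendsto_intros lim_flux lim_diff)
    then have "ennreal (2 * (\<integral>y. \<xi> y \<bullet> \<gamma>b y \<partial>\<pi>b) - (\<integral>y. \<xi> y \<bullet> (Ab y *v \<xi> y) \<partial>\<pi>b))
        = Liminf (at_right 0) (\<lambda>\<epsilon>. ennreal (2 * flux_\<epsilon> \<epsilon> - diff_\<epsilon> \<epsilon>))"
      by (rule lim_imp_Liminf[OF trivial_limit_at_right_real, symmetric])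
    also have "\<dots> \<le> Liminf (at_right 0) (\<lambda>\<epsilon>. sigma_hk_ss (A \<epsilon>) (\<gamma> \<epsilon>) (\<pi> \<epsilon>))"
      by (rule Liminf_mono) (use le \<epsilon>0 in \<open>auto simp: eventually_at_right_field\<close>)
    finally show ?thesis .
  qed
  show ?thesis
    unfolding sigma_hk_ss_def[of Ab]
  proof (rule variational_formula_continuous_tests[OF sets_b _ _ gb Ab pd_b bound])
    show "Eb \<in> sets borel"
      using assms(3) by simp
    show "AE y in \<pi>b. p y" if "AE y in lborel. p y" for p
      using that by (intro diffusion_semigroup.AE_pi_if_AE_lborel[OF macro assms(3)]) auto
  qed
qed

end
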